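(* Let $\Phi$ be an LWR frame, let $\lambda_0\ne\lambda_1\in\mathbb C$, and let $f^{\mathbb H}=\Psi^*\Psi$ with $\Psi=\Phi_{\lambda_1}\Phi_{\lambda_0}^{-1}$ be the CMC $1$ immersion into $\mathbb H^3$ induced by $\Phi$ at the evaluation points $(\lambda_0,\lambda_1)$. The dual of $f^{\mathbb H}$ is obtained by permuting $\lambda_0$ and $\lambda_1$; that is, the dual $(f^{\mathbb H})^\sharp$ is the immersion induced by $\Phi$ at the evaluation points $(\lambda_1,\lambda_0)$.
   Context: $\mathbb H^3=\{x\ \text{Hermitian } 2\times2:\det x=1,\operatorname{tr}x>0\}=\{FF^*:F\in \mathrm{SL}_2\mathbb C\}$. An LWR potential is a family $\xi_\lambda$ ($\lambda\in\mathbb C$) of $\mathrm{sl}_2\mathbb C$-valued 1-forms on a Riemann surface, locally $\xi_\lambda=(A\lambda+B)dz$ with $A,B$ holomorphic in $z$ and $A$ nilpotent. An LWR frame is a family $\Phi_\lambda$ of $\mathrm{SL}_2\mathbb C$-valued maps, holomorphic in $z$ and in $\lambda\in\mathbb C$, with $\Phi^{-1}d\Phi$ an LWR potential. The immersion into $\mathbb H^3$ induced by $\Phi$ at an ordered pair $(a,b)$ of distinct evaluation points is $\Psi^*\Psi$ with null curve $\Psi=\Phi_b\Phi_a^{-1}$. Dual: for a conformal CMC 1 immersion $f=\Psi^*\Psi$ given by a holomorphic null curve $\Psi$ into $\mathrm{SL}_2\mathbb C$ (holomorphic with $\det d\Psi\equiv0$), the dual of $f$ (with respect to $\Psi$) is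 $f^\sharp=(\Psi^{-1})^*\Psi^{-1}$. *)

theory Defs
  imports "HOL-Complex_Analysis.Complex_Analysis"
begin

type_synonym 'a chart = "'a set \<times> ('a \<Rightarrow> complex)"

definition chart_img :: "'a chart \<Rightarrow> complex set" where
  "chart_img c = snd c ` fst c"

definition in_chart :: "'a chart \<Rightarrow> ('a \<Rightarrow> 'b) \<Rightarrow> complex \<Rightarrow> 'b" where
  "in_chart c f = f \<circ> inv_into (fst c) (snd c)"

definition is_chart :: "'a topology \<Rightarrow> 'a chart \<Rightarrow> bool" where
  "is_chart M c \<longleftrightarrow> openin M (fst c) \<and> open (chart_img c) \<and>
     homeomorphic_map (subtopology M (fst c)) (top_of_set (chart_img c)) (snd c)"

text \<open>The atlas need not be maximal. Second countability is not required, as it follows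
  from the other conditions (Rado).\<close>

definition riemann_surface :: "'a topology \<Rightarrow> 'a chart set \<Rightarrow> bool" where
  "riemann_surface M \<A> \<longleftrightarrow> Hausdorff_space M \<and> connected_space M \<and>
     (\<forall>c\<in>\<A>. is_chart M c) \<and> (\<Union>c\<in>\<A>. fst c) = topspace M \<and>
     (\<forall>c\<in>\<A>. \<forall>d\<in>\<A>. in_chart c (snd d) holomorphic_on snd c ` (fst c \<inter> fst d))"

definition cadjoint :: "complex^2^2 \<Rightarrow> complex^2^2" where
  "cadjoint x = (\<chi> i j. cnj (x $ j $ i))"

definition SL2C :: "(complex^2^2) set" where
  "SL2C = {x. det x = 1}"

definition nilpotent_mat :: "complex^2^2 \<Rightarrow> bool" where
  "nilpotent_mat x \<longleftrightarrow> (\<exists>n::nat. ((\<lambda>y. x ** y) ^^ n) (mat 1) = 0)"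

definition mat_holomorphic_on :: "(complex \<Rightarrow> complex^2^2) \<Rightarrow> complex set \<Rightarrow> bool" where
  "mat_holomorphic_on F S \<longleftrightarrow> (\<forall>i j. (\<lambda>z. F z $ i $ j) holomorphic_on S)"

definition mat_deriv :: "(complex \<Rightarrow> complex^2^2) \<Rightarrow> complex \<Rightarrow> complex^2^2" where
  "mat_deriv F z = (\<chi> i j. deriv (\<lambda>w. F w $ i $ j) z)"

definition holomorphic_map :: "'a chart set \<Rightarrow> ('a \<Rightarrow> complex^2^2) \<Rightarrow> bool" where
  "holomorphic_map \<A> F \<longleftrightarrow> (\<forall>c\<in>\<A>. mat_holomorphic_on (in_chart c F) (chart_img c))"

text \<open>A matrix-valued form of type (1,0) is given by its coefficient with respect to dz for the
  coordinate z of each chart; the coefficients must transform as those of a form. The product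
  with \<^term>\<open>mat k\<close> is multiplication by the scalar k.\<close>

type_synonym 'a form = "'a chart \<Rightarrow> complex \<Rightarrow> complex^2^2"

definition one_form :: "'a chart set \<Rightarrow> 'a form \<Rightarrow> bool" where
  "one_form \<A> \<omega> \<longleftrightarrow> (\<forall>c\<in>\<A>. \<forall>d\<in>\<A>. \<forall>p\<in>fst c \<inter> fst d.
     \<omega> c (snd c p) = mat (deriv (in_chart c (snd d)) (snd c p)) ** \<omega> d (snd d p))"

definition log_deriv :: "('a \<Rightarrow> complex^2^2) \<Rightarrow> 'a form" where
  "log_deriv F c z = matrix_inv (in_chart c F z) ** mat_deriv (in_chart c F) z"

text \<open>The coefficients A and B are unique, since they are determined by the values of the
  potential at 0 and 1. Hence local decompositions glue over a chart.\<close>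

definition LWR_potential :: "'a chart set \<Rightarrow> (complex \<Rightarrow> 'a form) \<Rightarrow> bool" where
  "LWR_potential \<A> \<xi> \<longleftrightarrow>
     (\<forall>l. one_form \<A> (\<xi> l)) \<and>
     (\<forall>c\<in>\<A>. (\<forall>l. \<forall>z\<in>chart_img c. trace (\<xi> l c z) = 0) \<and>
       (\<exists>A B. mat_holomorphic_on A (chart_img c) \<and> mat_holomorphic_on B (chart_img c) \<and>
          (\<forall>z\<in>chart_img c. nilpotent_mat (A z)) \<and>
          (\<forall>l. \<forall>z\<in>chart_img c. \<xi> l c z = mat l ** A z + B z)))"

definition LWR_frame :: "'a topology \<Rightarrow> 'a chart set \<Rightarrow> (complex \<Rightarrow> 'a \<Rightarrow> complex^2^2) \<Rightarrow> bool" where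
  "LWR_frame M \<A> \<Phi> \<longleftrightarrow>
     (\<forall>l. \<forall>p\<in>topspace M. \<Phi> l p \<in> SL2C) \<and>
     (\<forall>l. holomorphic_map \<A> (\<Phi> l)) \<and>
     (\<forall>p\<in>topspace M. mat_holomorphic_on (\<lambda>l. \<Phi> l p) UNIV) \<and>
     LWR_potential \<A> (\<lambda>l. log_deriv (\<Phi> l))"

definition null_curve :: "'a topology \<Rightarrow> 'a chart set \<Rightarrow> ('a \<Rightarrow> complex^2^2) \<Rightarrow> bool" where
  "null_curve M \<A> \<Psi> \<longleftrightarrow> (\<forall>p\<in>topspace M. \<Psi> p \<in> SL2C) \<and> holomorphic_map \<A> \<Psi> \<and>
     (\<forall>c\<in>\<A>. \<forall>z\<in>chart_img c. det (mat_deriv (in_chart c \<Psi>) z) = 0)"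

definition induced_curve ::
    "(complex \<Rightarrow> 'a \<Rightarrow> complex^2^2) \<Rightarrow> complex \<times> complex \<Rightarrow> 'a \<Rightarrow> complex^2^2" where
  "induced_curve \<Phi> = (\<lambda>(a, b) p. \<Phi> b p ** matrix_inv (\<Phi> a p))"

definition induced_map ::
    "(complex \<Rightarrow> 'a \<Rightarrow> complex^2^2) \<Rightarrow> complex \<times> complex \<Rightarrow> 'a \<Rightarrow> complex^2^2" where
  "induced_map \<Phi> e p = cadjoint (induced_curve \<Phi> e p) ** induced_curve \<Phi> e p"

definition H3 :: "(complex^2^2) set" where
  "H3 = {x. cadjoint x = x \<and> det x = 1 \<and> Re (trace x) > 0}"

text \<open>Hermitian matrices form Minkowski space with quadratic form \<open>- det\<close>; the following is
  its polarization. It induces the metric of curvature -1 on \<^term>\<open>H3\<close>.\<close>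

definition mink :: "complex^2^2 \<Rightarrow> complex^2^2 \<Rightarrow> real" where
  "mink x y = Re (det x + det y - det (x + y)) / 2"

definition pderiv_dir ::
    "complex \<Rightarrow> (complex \<Rightarrow> 'b::real_normed_vector) \<Rightarrow> complex \<Rightarrow> 'b" where
  "pderiv_dir v h z = frechet_derivative h (at z) v"

primrec Ck_on :: "nat \<Rightarrow> complex set \<Rightarrow> (complex \<Rightarrow> 'b::real_normed_vector) \<Rightarrow> bool" where
  "Ck_on 0 S h \<longleftrightarrow> continuous_on S h"
| "Ck_on (Suc k) S h \<longleftrightarrow> (\<forall>z\<in>S. h differentiable at z) \<and> (\<forall>v. Ck_on k S (pderiv_dir v h))"

definition immersion :: "'a chart set \<Rightarrow> ('a \<Rightarrow> complex^2^2) \<Rightarrow> bool" where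
  "immersion \<A> f \<longleftrightarrow> (\<forall>c\<in>\<A>. (\<forall>k. Ck_on k (chart_img c) (in_chart c f)) \<and>
     (\<forall>z\<in>chart_img c. inj (frechet_derivative (in_chart c f) (at z))))"

definition conformal :: "'a chart set \<Rightarrow> ('a \<Rightarrow> complex^2^2) \<Rightarrow> bool" where
  "conformal \<A> f \<longleftrightarrow> (\<forall>c\<in>\<A>. \<forall>z\<in>chart_img c.
     let fx = pderiv_dir 1 (in_chart c f) z; fy = pderiv_dir \<i> (in_chart c f) z
     in mink fx fx = mink fy fy \<and> mink fx fy = 0)"

text \<open>Normal to the surface within \<^term>\<open>H3\<close>: the tangent space of \<^term>\<open>H3\<close> at \<open>f p\<close> consists of the
  Hermitian matrices orthogonal to \<open>f p\<close>.\<close>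

definition unit_normal ::
    "'a topology \<Rightarrow> 'a chart set \<Rightarrow> ('a \<Rightarrow> complex^2^2) \<Rightarrow> ('a \<Rightarrow> complex^2^2) \<Rightarrow> bool" where
  "unit_normal M \<A> f n \<longleftrightarrow> continuous_map M euclidean n \<and>
     (\<forall>p\<in>topspace M. cadjoint (n p) = n p \<and> mink (n p) (n p) = 1 \<and> mink (n p) (f p) = 0) \<and>
     (\<forall>c\<in>\<A>. \<forall>z\<in>chart_img c. \<forall>v. mink (in_chart c n z) (pderiv_dir v (in_chart c f) z) = 0)"

text \<open>Half the trace of the second fundamental form with respect to the first one. Derivatives
  are those of Minkowski space: the second derivatives of \<open>h\<close> differ from the covariant ones
  of \<^term>\<open>H3\<close> by multiples of \<open>h\<close>, which are orthogonal to the normal \<open>n\<close>.\<close>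

definition mean_curvature ::
    "(complex \<Rightarrow> complex^2^2) \<Rightarrow> (complex \<Rightarrow> complex^2^2) \<Rightarrow> complex \<Rightarrow> real" where
  "mean_curvature h n z =
     (let hx = pderiv_dir 1 h; hy = pderiv_dir \<i> h;
          e = mink (hx z) (hx z); f = mink (hx z) (hy z); g = mink (hy z) (hy z);
          l = mink (pderiv_dir 1 hx z) (n z); m = mink (pderiv_dir 1 hy z) (n z);
          k = mink (pderiv_dir \<i> hy z) (n z)
      in (l * g - 2 * m * f + k * e) / (2 * (e * g - f\<^sup>2)))"

definition conformal_CMC1_immersion ::
    "'a topology \<Rightarrow> 'a chart set \<Rightarrow> ('a \<Rightarrow> complex^2^2) \<Rightarrow> bool" where
  "conformal_CMC1_immersion M \<A> f \<longleftrightarrow>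
     f ` topspace M \<subseteq> H3 \<and> immersion \<A> f \<and> conformal \<A> f \<and>
     (\<exists>n. unit_normal M \<A> f n \<and>
       (\<forall>c\<in>\<A>. \<forall>z\<in>chart_img c. mean_curvature (in_chart c f) (in_chart c n) z = 1))"

text \<open>A relation, since the dual is defined only for a conformal CMC 1 immersion \<open>f\<close> that is
  given by a null curve \<open>\<Psi>\<close>; the dual \<open>g\<close> is taken with respect to \<open>\<Psi>\<close>.\<close>

definition is_dual :: "'a topology \<Rightarrow> 'a chart set \<Rightarrow> ('a \<Rightarrow> complex^2^2) \<Rightarrow>
    ('a \<Rightarrow> complex^2^2) \<Rightarrow> ('a \<Rightarrow> complex^2^2) \<Rightarrow> bool" where
  "is_dual M \<A> \<Psi> f g \<longleftrightarrow>
     null_curve M \<A> \<Psi> \<and> conformal_CMC1_immersion M \<A> f \<and>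
     (\<forall>p\<in>topspace M. f p = cadjoint (\<Psi> p) ** \<Psi> p) \<and>
     (\<forall>p\<in>topspace M. g p = cadjoint (matrix_inv (\<Psi> p)) ** matrix_inv (\<Psi> p))"

end

theory Submission
  imports Defs
begin

text \<open>
  Inverting \<open>\<Psi> = \<Phi>\<^sub>b \<Phi>\<^sub>a\<^sup>-\<^sup>1\<close> gives \<open>\<Phi>\<^sub>a \<Phi>\<^sub>b\<^sup>-\<^sup>1\<close>, the curve induced at the permuted evaluation points; this is
  the reason why the dual arises by permuting them (\<open>matrix_inv_induced_curve\<close>). To speak of a
  dual, however, \<open>\<Psi>\<close> has to be a null curve and \<open>\<Psi>\<^sup>* \<Psi>\<close> a conformal CMC 1 immersion, and the same has to
  hold for the inverse curve.

  Nullity comes from the shape of the potential: the derivative of \<open>\<Psi>\<close> is \<open>(b - a) \<Phi>\<^sub>b A \<Phi>\<^sub>a\<^sup>-\<^sup>1\<close> with \<open>A\<close>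
  nilpotent (\<open>null_curve_induced_curve\<close>).

  That \<open>f = \<Psi>\<^sup>* \<Psi>\<close> is conformal of mean curvature 1 is Bryant's theorem, for which a direct computation
  suffices. Put \<open>\<beta> = \<Psi>' \<Psi>\<^sup>-\<^sup>1\<close>. It has trace zero because \<open>det \<Psi> = 1\<close>, and determinant zero because \<open>\<Psi>\<close> is
  null, so \<open>\<beta> \<beta> = 0\<close>. The partial derivatives of \<open>f\<close> are \<open>\<Psi>\<^sup>* (v \<beta> + (v \<beta>)\<^sup>*) \<Psi>\<close> for \<open>v = 1, \<i>\<close>. As \<open>x \<mapsto> \<Psi>\<^sup>* x \<Psi>\<close> is an
  isometry of Minkowski space, the geometry of \<open>f\<close> reduces to identities for \<open>\<beta>\<close>: with \<open>q\<close> the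
  squared norm of \<open>\<beta>\<close>, the metric is \<open>q\<close> times the Euclidean one, \<open>n = \<Psi>\<^sup>* (\<beta>\<^sup>* \<beta> - \<beta> \<beta>\<^sup>*) \<Psi> / q\<close> is a unit
  normal, and the Laplacian of \<open>f\<close> is \<open>4 \<Psi>\<^sup>* \<beta>\<^sup>* \<beta> \<Psi>\<close>, with normal component \<open>2 q\<close>
  (\<open>mean_curvature_curve\<close>). A change of chart multiplies \<open>\<beta>\<close> by a nonzero scalar, under which \<open>n\<close> is
  invariant, so the normal exists globally (\<open>ex_global_normal\<close>).

  The metric shows also that \<open>f\<close> is an immersion exactly if \<open>\<Psi>'\<close> has no zeros. The inverse of a matrix
  in \<^term>\<open>SL2C\<close> is its adjugate, which is linear in the matrix, and hence the derivative of \<open>\<Psi>\<^sup>-\<^sup>1\<close> is the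
  adjugate of \<open>\<Psi>'\<close>. So the assumption that \<open>f\<close> is an immersion carries over to the inverse curve
  (\<open>null_curve_inverse\<close>).
\<close>

\<comment> \<open>The infix symbol is to denote matrix entries only.\<close>
no_notation fps_nth (infixl \<open>$\<close> 75)

section \<open>Adjugates and adjoints of two by two matrices\<close>

lemma mat2_eq_iff:
  fixes x y :: "'a^2^2"
  shows "x = y \<longleftrightarrow> x$1$1 = y$1$1 \<and> x$1$2 = y$1$2 \<and> x$2$1 = y$2$1 \<and> x$2$2 = y$2$2"
  by (auto simp: vec_eq_iff forall_2)

lemma mat2_mult_nth:
  fixes x y :: "'a::semiring_1^2^2"
  shows "(x ** y) $ i $ j = x$i$1 * y$1$j + x$i$2 * y$2$j"
  by (simp add: matrix_matrix_mult_def sum_2)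

lemma cadjoint_nth [simp]: "cadjoint x $ i $ j = cnj (x $ j $ i)"
  by (simp add: cadjoint_def)

lemma mat_nth_2 [simp]:
  fixes k :: "'a::zero"
  shows "mat k $ (1::2) $ 1 = k" "mat k $ (2::2) $ 2 = k"
    "mat k $ (1::2) $ 2 = 0" "mat k $ (2::2) $ 1 = 0"
  by (simp_all add: mat_def)

lemma trace_2: "trace (x::'a::comm_semiring_1^2^2) = x$1$1 + x$2$2"
  by (simp add: trace_def sum_2)

text \<open>The adjugate, in the form that Cayley-Hamilton gives it in size two. In this size it is linear,
  so unlike the inverse it commutes with differentiation; on \<^term>\<open>SL2C\<close> it is the inverse.\<close>

definition adj2 :: "'a::comm_ring_1^2^2 \<Rightarrow> 'a^2^2" where
  "adj2 x = mat (trace x) - x"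

lemmas mat2_simps = mat2_eq_iff mat2_mult_nth trace_2 det_2 adj2_def

lemma cadjoint_mult: "cadjoint (x ** y) = cadjoint y ** cadjoint x"
  by (simp add: mat2_simps mult.commute)

lemma cadjoint_cadjoint [simp]: "cadjoint (cadjoint x) = x"
  by (simp add: mat2_simps)

lemma det_cadjoint [simp]: "det (cadjoint x) = cnj (det x)"
  by (simp add: mat2_simps mult.commute)

lemma adj2_adj2 [simp]: "adj2 (adj2 x) = x"
  by (simp add: mat2_simps)

lemma adj2_mult: "adj2 (x ** y) = adj2 y ** adj2 x"
  by (simp add: mat2_simps algebra_simps)

lemma det_adj2 [simp]: "det (adj2 x) = det x"
  by (simp add: mat2_simps algebra_simps)

lemma trace_cadjoint [simp]: "trace (cadjoint x) = cnj (trace x)"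
  by (simp add: mat2_simps)

lemma adj2_eq_0_iff [simp]: "adj2 x = 0 \<longleftrightarrow> x = 0"
  by (auto simp: mat2_simps)

lemma mult_adj2: "x ** adj2 x = mat (det x)" "adj2 x ** x = mat (det x)"
  by (simp_all add: mat2_simps algebra_simps)

lemma matrix_inv_eq_adj2:
  fixes x :: "complex^2^2"
  assumes "det x = 1" shows "matrix_inv x = adj2 x"
proof -
  have inv: "x ** adj2 x = mat 1" "adj2 x ** x = mat 1"
    using mult_adj2[of x] assms by simp_all
  then have "x ** matrix_inv x = mat 1 \<and> matrix_inv x ** x = mat 1"
    unfolding matrix_inv_def by (rule_tac someI[of _ "adj2 x"]) simp
  then show ?thesis
    by (metis inv(2) matrix_mul_assoc matrix_mul_lid matrix_mul_rid)
qed

text \<open>The power in \<^const>\<open>nilpotent_mat\<close> has determinant \<open>det x ^ n\<close>.\<close>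

lemma det_eq_0_if_nilpotent:
  assumes "nilpotent_mat x" shows "det x = 0"
proof -
  obtain n where "((\<lambda>y. x ** y) ^^ n) (mat 1) = 0"
    using assms by (auto simp: nilpotent_mat_def)
  moreover have "det (((\<lambda>y. x ** y) ^^ n) (mat 1)) = det x ^ n"
    by (induction n) (simp_all add: det_mul)
  moreover have "det (0 :: complex^2^2) = 0"
    by (simp add: det_2)
  ultimately show ?thesis
    by simp
qed

section \<open>Null directions in Minkowski space\<close>

text \<open>In trace form the polarized determinant becomes visibly bilinear, and the products of null
  matrices that occur below can be evaluated by rotating factors under the trace.\<close>

lemma mink_trace: "mink x y = Re (trace (x ** y) - trace x * trace y) / 2"
  by (simp add: mink_def mat2_simps algebra_simps)

text \<open>The spinor action of \<^term>\<open>SL2C\<close> on Minkowski space is by isometries. It moves every question about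
  the surface at a point \<open>F\<^sup>* F\<close> to a question about matrices at the base point \<^term>\<open>mat 1\<close>.\<close>

lemma mink_congruence:
  assumes "det F = 1"
  shows "mink (cadjoint F ** x ** F) (cadjoint F ** y ** F) = mink x y"
proof -
  have "det (cadjoint F ** z ** F) = det z" for z
    by (simp add: det_mul assms)
  moreover have "cadjoint F ** x ** F + cadjoint F ** y ** F = cadjoint F ** (x + y) ** F"
    by (simp add: mat2_simps algebra_simps)
  ultimately show ?thesis
    by (simp add: mink_def)
qed

lemma mink_commute: "mink x y = mink y x"
  by (simp add: mink_def add.commute)

lemma mink_add_left: "mink (x + y) z = mink x z + mink y z"
  by (simp add: mink_trace mat2_simps algebra_simps add_divide_distrib diff_divide_distrib)

lemma mink_scaleR_left: "mink (r *\<^sub>R x) y = r * mink x y"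
  by (simp add: mink_trace mat2_simps algebra_simps)

lemma mink_add_right: "mink z (x + y) = mink z x + mink z y"
  by (simp add: mink_commute[of z] mink_add_left)

lemma mink_scaleR_right: "mink y (r *\<^sub>R x) = r * mink y x"
  by (simp add: mink_commute[of y] mink_scaleR_left)

lemma H3_cadjoint_mult:
  assumes "det F = 1" shows "cadjoint F ** F \<in> H3"
proof -
  have "Re (trace (cadjoint F ** F)) =
      (cmod (F$1$1))\<^sup>2 + (cmod (F$1$2))\<^sup>2 + (cmod (F$2$1))\<^sup>2 + (cmod (F$2$2))\<^sup>2"
    unfolding cmod_power2 by (simp add: mat2_simps power2_eq_square)
  moreover have "F$1$1 \<noteq> 0 \<or> F$1$2 \<noteq> 0"
    using assms by (auto simp: det_2)
  then have "(cmod (F$1$1))\<^sup>2 + (cmod (F$1$2))\<^sup>2 > 0"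
    by (smt (verit) zero_less_norm_iff zero_less_power zero_le_power2)
  ultimately show ?thesis
    by (smt (verit, best) H3_def assms cadjoint_cadjoint cadjoint_mult complex_cnj_one det_cadjoint
        det_mul mem_Collect_eq mult.right_neutral zero_le_power2)
qed

text \<open>Twice the Hermitian part: the tangent vector at the base point \<^term>\<open>mat 1\<close> of the surface with
  logarithmic derivative \<open>x\<close>.\<close>

definition herm :: "complex^2^2 \<Rightarrow> complex^2^2" where
  "herm x = x + cadjoint x"

text \<open>The square of the Frobenius norm.\<close>

definition sqnorm :: "complex^2^2 \<Rightarrow> real" where
  "sqnorm x = Re (trace (cadjoint x ** x))"

text \<open>For \<open>x \<noteq> 0\<close> of trace and determinant zero, the Hermitian matrices orthogonal to \<^term>\<open>mat 1\<close>
  and to the tangent plane spanned by \<^term>\<open>herm x\<close> and \<^term>\<open>herm (mat \<i> ** x)\<close> are the real multiples of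
  the commutator of \<open>x\<^sup>*\<close> and \<open>x\<close>. The factor makes it a unit vector; of the two signs, this one gives
  mean curvature 1 rather than -1.\<close>

definition normal_dir :: "complex^2^2 \<Rightarrow> complex^2^2" where
  "normal_dir x = (1 / sqnorm x) *\<^sub>R (cadjoint x ** x - x ** cadjoint x)"

lemma mat_scaleR_nth: "(r *\<^sub>R x) $ i $ j = of_real r * (x $ i $ j :: complex)"
  by (simp add: complex_eq_iff)

lemma sqnorm_scale: "sqnorm (mat v ** x) = (cmod v)\<^sup>2 * sqnorm x"
  unfolding cmod_power2 by (simp add: sqnorm_def mat2_simps power2_eq_square algebra_simps)

text \<open>Cayley-Hamilton.\<close>

lemma mat2_square:
  fixes x :: "complex^2^2"
  shows "x ** x = mat (trace x) ** x - mat (det x)"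
  by (simp add: mat2_simps algebra_simps)

lemma trace_zero: "trace (0 :: complex^2^2) = 0"
  by (simp add: trace_2)

lemma trace_minus: "trace (- x) = - trace x" for x :: "complex^2^2"
  by (simp add: trace_2)

lemma mat2_distribs:
  fixes x y z :: "complex^2^2"
  shows "x ** (y + z) = x ** y + x ** z" "(y + z) ** x = y ** x + z ** x"
    "x ** (y - z) = x ** y - x ** z" "(y - z) ** x = y ** x - z ** x"
  by (simp_all add: mat2_simps algebra_simps)

lemma mat_0 [simp]: "mat 0 = (0 :: 'a::zero^2^2)"
  by (simp add: mat2_simps)

lemma sqnorm_eq: "trace (cadjoint x ** x) = of_real (sqnorm x)"
  by (simp add: complex_eq_iff sqnorm_def mat2_simps)

context
  fixes x :: "complex^2^2"
  assumes null: "trace x = 0" "det x = 0"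
begin

lemma null_square:
  "x ** x = 0" "cadjoint x ** cadjoint x = 0"
  by (simp_all add: mat2_square null mat2_distribs)

lemma mink_herm_same: "mink (herm x) (herm x) = sqnorm x"
proof -
  have "trace (herm x) = 0"
    by (simp add: herm_def trace_add null)
  moreover have "trace (herm x ** herm x) = of_real (2 * sqnorm x)"
    by (simp add: herm_def mat2_distribs trace_add null_square trace_mul_sym[of x] sqnorm_eq)
  ultimately show ?thesis
    by (simp add: mink_trace)
qed

lemma mink_normal_herm: "mink (normal_dir x) (herm x) = 0"
proof -
  have "trace (cadjoint x ** x ** cadjoint x) = 0" "trace (x ** cadjoint x ** x) = 0"
    using trace_mul_sym[of "cadjoint x ** x" "cadjoint x"] trace_mul_sym[of "x ** cadjoint x" x]
    by (simp_all add: matrix_mul_assoc null_square trace_zero)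
  then have "trace ((cadjoint x ** x - x ** cadjoint x) ** herm x) = 0"
    by (simp add: herm_def mat2_distribs trace_add trace_sub null_square flip: matrix_mul_assoc)
  moreover have "trace (herm x) = 0"
    by (simp add: herm_def trace_add null)
  ultimately show ?thesis
    unfolding normal_dir_def mink_scaleR_left by (simp add: mink_trace)
qed

text \<open>The two summands of the commutator are of rank at most one, so by Cayley-Hamilton the square of each
  is its trace times itself, and their products with each other contain the factor \<open>x ** x = 0\<close>.\<close>

lemma mink_commutator:
  "mink (cadjoint x ** x) (cadjoint x ** x - x ** cadjoint x) = (sqnorm x)\<^sup>2 / 2"
  "mink (x ** cadjoint x) (cadjoint x ** x - x ** cadjoint x) = - (sqnorm x)\<^sup>2 / 2"
proof -
  let ?P = "cadjoint x ** x" and ?Q = "x ** cadjoint x"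
  have tr: "trace ?P = of_real (sqnorm x)" "trace ?Q = of_real (sqnorm x)"
    by (simp_all add: sqnorm_eq trace_mul_sym[of x])
  have "det ?P = 0" "det ?Q = 0"
    by (simp_all add: det_mul null)
  then have "trace (?P ** ?P) = of_real ((sqnorm x)\<^sup>2)" "trace (?Q ** ?Q) = of_real ((sqnorm x)\<^sup>2)"
    unfolding mat2_square[of ?P] mat2_square[of ?Q] tr
    using tr by (simp_all add: trace_sub mat2_mult_nth trace_2 power2_eq_square flip: distrib_left)
  moreover have "?P ** ?Q = 0" "?Q ** ?P = 0"
    by (metis matrix_mul_assoc null_square times0_left times0_right)+
  ultimately show "mink ?P (?P - ?Q) = (sqnorm x)\<^sup>2 / 2" "mink ?Q (?P - ?Q) = - (sqnorm x)\<^sup>2 / 2"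
    by (simp_all add: mink_trace mat2_distribs trace_sub trace_minus tr)
qed

end

lemma sqnorm_pos_iff: "sqnorm x > 0 \<longleftrightarrow> x \<noteq> 0"
proof -
  have *: "sqnorm x = (cmod (x$1$1))\<^sup>2 + (cmod (x$1$2))\<^sup>2 + (cmod (x$2$1))\<^sup>2 + (cmod (x$2$2))\<^sup>2"
    unfolding cmod_power2 by (simp add: sqnorm_def mat2_simps power2_eq_square)
  show ?thesis
    unfolding * mat2_eq_iff
    by (smt (verit) norm_eq_zero zero_eq_power2 zero_index zero_le_power2)
qed

context
  fixes x :: "complex^2^2"
  assumes null: "trace x = 0" "det x = 0" and nz: "x \<noteq> 0"
begin

lemma mink_normal_square:
  "mink (cadjoint x ** x) (normal_dir x) = sqnorm x / 2"
  "mink (x ** cadjoint x) (normal_dir x) = - sqnorm x / 2"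
  using sqnorm_pos_iff[of x] nz mink_commutator[OF null]
  by (simp_all add: normal_dir_def mink_scaleR_right power2_eq_square)

lemma mink_normal_same: "mink (normal_dir x) (normal_dir x) = 1"
proof -
  have "mink (cadjoint x ** x - x ** cadjoint x) (normal_dir x) = sqnorm x"
    using mink_normal_square
      mink_add_left[of "cadjoint x ** x - x ** cadjoint x" "x ** cadjoint x" "normal_dir x"]
    by simp
  then show ?thesis
    using sqnorm_pos_iff[of x] nz by (subst normal_dir_def) (simp add: mink_scaleR_left)
qed

end

lemma mink_normal_one: "mink (normal_dir x) (mat 1) = 0"
  unfolding normal_dir_def mink_scaleR_left
  by (simp add: mink_trace mat2_simps algebra_simps)

lemma cadjoint_normal_dir [simp]: "cadjoint (normal_dir x) = normal_dir x"
  by (simp add: normal_dir_def mat2_simps)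

text \<open>The normal depends only on the complex line of \<open>x\<close>. This makes it independent of the
  coordinate in which the logarithmic derivative is taken.\<close>

lemma normal_dir_scale:
  assumes "k \<noteq> 0"
  shows "normal_dir (mat k ** x) = normal_dir x"
proof -
  have k: "cnj k * k = of_real ((cmod k)\<^sup>2)"
    by (metis complex_norm_square mult.commute)
  have *: "cadjoint (mat k ** x) ** (mat k ** x) - mat k ** x ** cadjoint (mat k ** x)
    = (cmod k)\<^sup>2 *\<^sub>R (cadjoint x ** x - x ** cadjoint x)"
    unfolding mat2_eq_iff mat_scaleR_nth k[symmetric]
    by (simp add: mat2_mult_nth algebra_simps)
  show ?thesis
    unfolding normal_dir_def * sqnorm_scale using assms by simp
qed

lemma mink_herm_scale:
  assumes "trace x = 0" "det x = 0"
  shows "mink (herm (mat v ** x)) (herm (mat v ** x)) = (cmod v)\<^sup>2 * sqnorm x"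
    and "mink (normal_dir x) (herm (mat v ** x)) = 0"
proof -
  have null: "trace (mat v ** x) = 0" "det (mat v ** x) = 0"
    using assms by (simp_all add: det_mul) (simp add: mat2_simps flip: distrib_left)
  show "mink (herm (mat v ** x)) (herm (mat v ** x)) = (cmod v)\<^sup>2 * sqnorm x"
    by (simp add: mink_herm_same[OF null] sqnorm_scale)
  show "mink (normal_dir x) (herm (mat v ** x)) = 0"
  proof (cases "v = 0")
    case True
    then show ?thesis
      by (simp add: mink_trace herm_def mat2_simps)
  next
    case False
    then show ?thesis
      using mink_normal_herm[OF null] by (simp add: normal_dir_scale)
  qed
qed

text \<open>Polarization: the squared lengths of the tangent vectors in the directions \<open>1\<close>, \<open>\<i>\<close> and
  \<open>1 + \<i>\<close> are in the ratio 1 : 1 : 2.\<close>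

lemma mink_herm_i:
  assumes "trace x = 0" "det x = 0"
  shows "mink (herm x) (herm (mat \<i> ** x)) = 0"
proof -
  have "herm (mat (1 + \<i>) ** x) = herm x + herm (mat \<i> ** x)"
    by (simp add: herm_def mat2_simps algebra_simps)
  then have "mink (herm x + herm (mat \<i> ** x)) (herm x + herm (mat \<i> ** x)) = 2 * sqnorm x"
    using mink_herm_scale(1)[OF assms, of "1 + \<i>"] by (simp add: cmod_power2)
  moreover have "mink (herm (mat \<i> ** x)) (herm (mat \<i> ** x)) = sqnorm x"
    using mink_herm_scale(1)[OF assms, of \<i>] by simp
  ultimately show ?thesis
    using mink_herm_same[OF assms]
    by (simp add: mink_add_left mink_add_right mink_commute[of "herm (mat \<i> ** x)" "herm x"])
qed

section \<open>Derivatives of matrix-valued functions\<close>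

lemma mat_mult_nth [simp]: "(mat v ** x) $ i $ j = v * x $ i $ j" for x :: "complex^2^2"
  using exhaust_2[of i] by (auto simp: mat2_mult_nth)

lemma has_derivative_mat2:
  fixes F :: "'a::real_normed_vector \<Rightarrow> complex^2^2"
  assumes "\<And>i j. ((\<lambda>z. F z $ i $ j) has_derivative (\<lambda>v. F' v $ i $ j)) (at z)"
  shows "(F has_derivative F') (at z)"
proof -
  have "((\<lambda>z. F z \<bullet> b) has_derivative (\<lambda>v. F' v \<bullet> b)) (at z)" if b: "b \<in> Basis" for b
  proof -
    obtain i j u where "b = axis i (axis j u)"
      using b by (auto simp: Basis_vec_def)
    then show ?thesis
      using has_derivative_inner_left[OF assms[of i j], of u] by (simp add: inner_axis)
  qed
  then show ?thesis
    by (subst has_derivative_componentwise_within) simp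
qed

lemma mat_holomorphic_on_mult:
  "mat_holomorphic_on F S \<Longrightarrow> mat_holomorphic_on G S \<Longrightarrow> mat_holomorphic_on (\<lambda>z. F z ** G z) S"
  unfolding mat_holomorphic_on_def mat2_mult_nth by (intro allI holomorphic_intros) auto

lemma mat_holomorphic_on_scale:
  "mat_holomorphic_on F S \<Longrightarrow> mat_holomorphic_on (\<lambda>z. mat v ** F z) S"
  unfolding mat_holomorphic_on_def mat_mult_nth by (intro allI holomorphic_intros) auto

lemma adj2_nth:
  fixes x :: "complex^2^2"
  shows "adj2 x $ i $ j = (if i = j then x$1$1 + x$2$2 else 0) - x $ i $ j"
  by (simp add: adj2_def trace_2 mat_def)

lemma mat_holomorphic_on_adj2:
  "mat_holomorphic_on F S \<Longrightarrow> mat_holomorphic_on (\<lambda>z. adj2 (F z)) S"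
  unfolding mat_holomorphic_on_def adj2_nth
  by (intro allI, case_tac "i = j") (auto intro!: holomorphic_intros)

lemma mat_holomorphic_on_cong:
  assumes "\<And>z. z \<in> S \<Longrightarrow> F z = G z"
  shows "mat_holomorphic_on F S \<longleftrightarrow> mat_holomorphic_on G S"
proof -
  have "(\<lambda>z. F z $ i $ j) holomorphic_on S \<longleftrightarrow> (\<lambda>z. G z $ i $ j) holomorphic_on S" for i j
    by (rule holomorphic_cong) (simp_all add: assms)
  then show ?thesis
    by (simp add: mat_holomorphic_on_def)
qed

lemma mat_deriv_eqI:
  assumes "\<And>i j. ((\<lambda>w. F w $ i $ j) has_field_derivative D $ i $ j) (at z)"
  shows "mat_deriv F z = D"
  using assms by (auto simp: mat_deriv_def vec_eq_iff intro: DERIV_imp_deriv)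

lemma mat_deriv_cong:
  assumes "open S" "z \<in> S" "\<And>w. w \<in> S \<Longrightarrow> F w = G w"
  shows "mat_deriv F z = mat_deriv G z"
proof -
  have "\<forall>\<^sub>F w in nhds z. F w = G w"
    using assms by (auto simp: eventually_nhds)
  then have "\<forall>\<^sub>F w in nhds z. F w $ i $ j = G w $ i $ j" for i j
    by (rule eventually_mono) simp
  then have "deriv (\<lambda>w. F w $ i $ j) z = deriv (\<lambda>w. G w $ i $ j) z" for i j
    by (intro deriv_cong_ev) simp_all
  then show ?thesis
    by (simp add: mat_deriv_def)
qed

lemma has_derivative_cong_open:
  assumes "open S" "z \<in> S" "\<And>w. w \<in> S \<Longrightarrow> f w = g w"
  shows "(f has_derivative D) (at z) \<longleftrightarrow> (g has_derivative D) (at z)"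
proof
  show "(g has_derivative D) (at z)" if "(f has_derivative D) (at z)"
    using that assms by (rule has_derivative_transform_within_open)
  show "(f has_derivative D) (at z)" if "(g has_derivative D) (at z)"
    using that assms(1,2) by (rule has_derivative_transform_within_open) (simp add: assms(3))
qed

lemma pderiv_dir_cong:
  assumes "open S" "z \<in> S" "\<And>w. w \<in> S \<Longrightarrow> f w = g w"
  shows "pderiv_dir v f z = pderiv_dir v g z"
  unfolding pderiv_dir_def frechet_derivative_def
  using has_derivative_cong_open[OF assms] by simp

lemma pderiv_dir_eq: "(f has_derivative D) (at z) \<Longrightarrow> pderiv_dir v f z = D v"
  by (simp add: pderiv_dir_def frechet_derivative_at[symmetric])

lemma Ck_on_cong:
  assumes "open S" "\<And>z. z \<in> S \<Longrightarrow> f z = g z"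
  shows "Ck_on k S f \<longleftrightarrow> Ck_on k S g"
  using assms(2)
proof (induction k arbitrary: f g)
  case 0
  then show ?case
    using continuous_on_cong[of S S f g] by simp
next
  case (Suc k)
  have "f differentiable at z \<longleftrightarrow> g differentiable at z" if "z \<in> S" for z
    unfolding differentiable_def
    using has_derivative_cong_open[OF assms(1) that Suc.prems] by simp
  moreover have "Ck_on k S (pderiv_dir v f) \<longleftrightarrow> Ck_on k S (pderiv_dir v g)" for v
    by (rule Suc.IH) (rule pderiv_dir_cong[OF assms(1)], simp_all add: Suc.prems)
  ultimately show ?case
    by simp
qed

lemma Ck_on_add:
  assumes "open S" "Ck_on k S f" "Ck_on k S g"
  shows "Ck_on k S (\<lambda>z. f z + g z)"
  using assms(2,3)
proof (induction k arbitrary: f g)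
  case 0
  then show ?case
    by (simp add: continuous_on_add)
next
  case (Suc k)
  have *: "pderiv_dir v (\<lambda>z. f z + g z) z = pderiv_dir v f z + pderiv_dir v g z"
    if "z \<in> S" for v z
  proof -
    have "(f has_derivative frechet_derivative f (at z)) (at z)"
      "(g has_derivative frechet_derivative g (at z)) (at z)"
      using Suc.prems that by (simp_all add: frechet_derivative_works)
    then show ?thesis
      using pderiv_dir_eq[OF has_derivative_add] by (simp add: pderiv_dir_def)
  qed
  have "Ck_on k S (pderiv_dir v (\<lambda>z. f z + g z))" for v
    by (rule iffD2[OF Ck_on_cong[OF assms(1) *]]) (use Suc in simp_all)
  then show ?case
    using Suc.prems by (simp add: differentiable_add)
qed

context
  fixes S :: "complex set"
  assumes open_S: "open S"
begin

lemma mat_holomorphic_on_deriv: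
  "mat_holomorphic_on F S \<Longrightarrow> mat_holomorphic_on (mat_deriv F) S"
  using open_S by (auto simp: mat_holomorphic_on_def mat_deriv_def intro: holomorphic_deriv)

lemma mat_entry_has_field_derivative:
  assumes "mat_holomorphic_on F S" "z \<in> S"
  shows "((\<lambda>w. F w $ i $ j) has_field_derivative mat_deriv F z $ i $ j) (at z)"
  using assms open_S by (auto simp: mat_holomorphic_on_def mat_deriv_def intro: holomorphic_derivI)

lemma mat_deriv_mult:
  assumes "mat_holomorphic_on F S" "mat_holomorphic_on G S" "z \<in> S"
  shows "mat_deriv (\<lambda>w. F w ** G w) z = mat_deriv F z ** G z + F z ** mat_deriv G z"
  unfolding mat2_mult_nth
  by (rule mat_deriv_eqI)
    (auto simp: mat2_mult_nth intro!: derivative_eq_intros mat_entry_has_field_derivative assms)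

lemma mat_deriv_scale:
  assumes "mat_holomorphic_on F S" "z \<in> S"
  shows "mat_deriv (\<lambda>w. mat v ** F w) z = mat v ** mat_deriv F z"
  by (rule mat_deriv_eqI)
    (auto intro!: derivative_eq_intros mat_entry_has_field_derivative assms)

lemma mat_deriv_adj2:
  assumes "mat_holomorphic_on F S" "z \<in> S"
  shows "mat_deriv (\<lambda>w. adj2 (F w)) z = adj2 (mat_deriv F z)"
  by (rule mat_deriv_eqI)
    (auto simp: adj2_nth intro!: derivative_eq_intros mat_entry_has_field_derivative assms)

lemma has_derivative_mat_holomorphic:
  assumes "mat_holomorphic_on F S" "z \<in> S"
  shows "(F has_derivative (\<lambda>v. mat v ** mat_deriv F z)) (at z)"
proof (rule has_derivative_mat2)
  show "((\<lambda>z. F z $ i $ j) has_derivative (\<lambda>v. (mat v ** mat_deriv F z) $ i $ j)) (at z)" for i j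
    using mat_entry_has_field_derivative[OF assms, of i j]
    by (simp add: has_field_derivative_def mult_commute_abs)
qed

text \<open>The product rule for one antiholomorphic and one holomorphic factor. Two different functions are
  admitted because the derivative is then a sum of two products of the same kind, which is what
  makes the induction for smoothness and the computation of second derivatives possible.\<close>

lemma has_derivative_cadjoint_mult:
  assumes F: "mat_holomorphic_on F S" and G: "mat_holomorphic_on G S" and z: "z \<in> S"
  shows "((\<lambda>w. cadjoint (F w) ** G w) has_derivative
    (\<lambda>v. cadjoint (mat v ** mat_deriv F z) ** G z + cadjoint (F z) ** (mat v ** mat_deriv G z))) (at z)"
proof (rule has_derivative_mat2)
  have D: "((\<lambda>w. H w $ i $ j) has_derivative (\<lambda>v. v * mat_deriv H z $ i $ j)) (at z)"
    if "mat_holomorphic_on H S" for H i j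
    using mat_entry_has_field_derivative[OF that z, of i j]
    by (simp add: has_field_derivative_def mult_commute_abs)
  show "((\<lambda>w. (cadjoint (F w) ** G w) $ i $ j) has_derivative
    (\<lambda>v. (cadjoint (mat v ** mat_deriv F z) ** G z
      + cadjoint (F z) ** (mat v ** mat_deriv G z)) $ i $ j)) (at z)" for i j
    unfolding mat2_mult_nth
    by (auto simp: mat2_mult_nth algebra_simps intro!: derivative_eq_intros D F G)
qed

lemmas pderiv_dir_cadjoint_mult = pderiv_dir_eq[OF has_derivative_cadjoint_mult]

lemma Ck_on_cadjoint_mult:
  assumes "mat_holomorphic_on F S" "mat_holomorphic_on G S"
  shows "Ck_on k S (\<lambda>w. cadjoint (F w) ** G w)"
  using assms
proof (induction k arbitrary: F G)
  case 0
  then show ?case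
    using has_derivative_cadjoint_mult[OF 0]
    by (auto intro!: continuous_at_imp_continuous_on has_derivative_continuous)
next
  case (Suc k)
  have "Ck_on k S (pderiv_dir v (\<lambda>w. cadjoint (F w) ** G w))" for v
    by (rule iffD2[OF Ck_on_cong[OF open_S pderiv_dir_cadjoint_mult[OF Suc.prems]]])
      (assumption | intro Ck_on_add open_S Suc mat_holomorphic_on_scale mat_holomorphic_on_deriv)+
  then show ?case
    using has_derivative_cadjoint_mult[OF Suc.prems] by (auto simp: differentiable_def)
qed

text \<open>In the sum of the two unmixed second derivatives, those of the two factors cancel since the second
  derivative of a holomorphic function in direction \<open>\<i>\<close> is minus that in direction 1; what
  remains is four times the mixed complex derivative.\<close>

lemma laplacian_cadjoint_mult:
  assumes F: "mat_holomorphic_on F S" and z: "z \<in> S"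
  shows "pderiv_dir 1 (pderiv_dir 1 (\<lambda>w. cadjoint (F w) ** F w)) z
      + pderiv_dir \<i> (pderiv_dir \<i> (\<lambda>w. cadjoint (F w) ** F w)) z
    = 4 *\<^sub>R (cadjoint (mat_deriv F z) ** mat_deriv F z)"
proof -
  note F' = mat_holomorphic_on_deriv[OF F]
  have second: "pderiv_dir v (pderiv_dir v (\<lambda>w. cadjoint (F w) ** F w)) z
    = (cadjoint (mat v ** (mat v ** mat_deriv (mat_deriv F) z)) ** F z
      + cadjoint (mat v ** mat_deriv F z) ** (mat v ** mat_deriv F z))
      + (cadjoint (mat v ** mat_deriv F z) ** (mat v ** mat_deriv F z)
      + cadjoint (F z) ** (mat v ** (mat v ** mat_deriv (mat_deriv F) z)))" for v
  proof -
    have "pderiv_dir v (pderiv_dir v (\<lambda>w. cadjoint (F w) ** F w)) z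
      = pderiv_dir v (\<lambda>w. cadjoint (mat v ** mat_deriv F w) ** F w
        + cadjoint (F w) ** (mat v ** mat_deriv F w)) z"
      by (rule pderiv_dir_cong[OF open_S z]) (rule pderiv_dir_cadjoint_mult[OF F F])
    also have "\<dots> = (cadjoint (mat v ** mat_deriv (\<lambda>w. mat v ** mat_deriv F w) z) ** F z
      + cadjoint (mat v ** mat_deriv F z) ** (mat v ** mat_deriv F z))
      + (cadjoint (mat v ** mat_deriv F z) ** (mat v ** mat_deriv F z)
      + cadjoint (F z) ** (mat v ** mat_deriv (\<lambda>w. mat v ** mat_deriv F w) z))"
      by (rule pderiv_dir_eq)
        (intro has_derivative_add has_derivative_cadjoint_mult mat_holomorphic_on_scale F F' z)
    finally show ?thesis
      by (simp only: mat_deriv_scale[OF F' z])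
  qed
  show ?thesis
    unfolding second mat2_eq_iff mat_scaleR_nth
    by (simp add: mat2_mult_nth algebra_simps)
qed

end

section \<open>The surface of a null curve in a coordinate domain\<close>

text \<open>This is \<open>F' F\<^sup>-\<^sup>1\<close> for \<open>F\<close> with values in \<^term>\<open>SL2C\<close>. The right logarithmic derivative is used because
  the derivative of \<open>F\<^sup>* F\<close> is then congruent, by \<open>F\<close> itself, to \<^const>\<open>herm\<close> of it.\<close>

definition right_log_deriv :: "(complex \<Rightarrow> complex^2^2) \<Rightarrow> complex \<Rightarrow> complex^2^2" where
  "right_log_deriv F z = mat_deriv F z ** adj2 (F z)"

definition curve_normal :: "(complex \<Rightarrow> complex^2^2) \<Rightarrow> complex \<Rightarrow> complex^2^2" where
  "curve_normal F z = cadjoint (F z) ** normal_dir (right_log_deriv F z) ** F z"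

context
  fixes S :: "complex set" and F :: "complex \<Rightarrow> complex^2^2" and z :: complex
  assumes open_S: "open S" and hol: "mat_holomorphic_on F S"
    and det_F: "\<And>w. w \<in> S \<Longrightarrow> det (F w) = 1"
    and null_F: "det (mat_deriv F z) = 0"
    and z: "z \<in> S"
begin

lemma mat_deriv_eq_right_log_deriv: "mat_deriv F z = right_log_deriv F z ** F z"
  by (simp add: right_log_deriv_def mult_adj2 det_F z flip: matrix_mul_assoc)

text \<open>The trace is the derivative of \<open>det F\<close>, which is constant.\<close>

lemma trace_right_log_deriv: "trace (right_log_deriv F z) = 0"
proof -
  have "((\<lambda>w. det (F w)) has_field_derivative trace (right_log_deriv F z)) (at z)"
    unfolding det_2
    by (auto simp: right_log_deriv_def mat2_simps algebra_simps
        intro!: derivative_eq_intros mat_entry_has_field_derivative[OF open_S hol z])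
  moreover have "((\<lambda>w. det (F w)) has_field_derivative 0) (at z)"
    by (rule has_field_derivative_transform_within_open[OF DERIV_const open_S z])
      (simp add: det_F)
  ultimately show ?thesis
    by (rule DERIV_unique)
qed

lemma det_right_log_deriv: "det (right_log_deriv F z) = 0"
  by (simp add: right_log_deriv_def det_mul null_F)

lemma right_log_deriv_eq_0_iff: "right_log_deriv F z = 0 \<longleftrightarrow> mat_deriv F z = 0"
  by (metis mat_deriv_eq_right_log_deriv right_log_deriv_def times0_left)

text \<open>All first order data of the surface thus come from the null matrix \<^term>\<open>right_log_deriv F z\<close>, carried
  from the base point by the isometry that \<open>F z\<close> induces.\<close>

lemma pderiv_dir_curve:
  "pderiv_dir v (\<lambda>w. cadjoint (F w) ** F w) z
    = cadjoint (F z) ** herm (mat v ** right_log_deriv F z) ** F z"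
  unfolding pderiv_dir_cadjoint_mult[OF open_S hol hol z] mat_deriv_eq_right_log_deriv
  by (simp add: herm_def mat2_distribs cadjoint_mult matrix_mul_assoc add.commute)

lemmas null_right_log_deriv = trace_right_log_deriv det_right_log_deriv

lemma first_fundamental_form:
  defines "h \<equiv> \<lambda>w. cadjoint (F w) ** F w"
  shows "mink (pderiv_dir v h z) (pderiv_dir v h z) = (cmod v)\<^sup>2 * sqnorm (right_log_deriv F z)"
    and "mink (pderiv_dir 1 h z) (pderiv_dir \<i> h z) = 0"
  using mink_herm_i[OF null_right_log_deriv]
  by (simp_all add: h_def pderiv_dir_curve mink_congruence det_F z
      mink_herm_scale[OF null_right_log_deriv])

text \<open>A conformal map is immersed where its conformal factor does not vanish, and this factor is the
  squared norm of the logarithmic derivative of \<open>F\<close>.\<close>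

lemma inj_frechet_derivative_curve_iff:
  "inj (frechet_derivative (\<lambda>w. cadjoint (F w) ** F w) (at z)) \<longleftrightarrow> mat_deriv F z \<noteq> 0"
proof -
  let ?h = "\<lambda>w. cadjoint (F w) ** F w"
  let ?D = "frechet_derivative ?h (at z)"
  have D: "?D v = pderiv_dir v ?h z" for v
    by (simp add: pderiv_dir_def)
  have "(?h has_derivative ?D) (at z)"
    using has_derivative_cadjoint_mult[OF open_S hol hol z]
    unfolding frechet_derivative_works[symmetric] differentiable_def by blast
  then have "linear ?D"
    by (rule has_derivative_linear)
  then have inj: "inj ?D \<longleftrightarrow> (\<forall>v. ?D v = 0 \<longrightarrow> v = 0)"
    by (rule linear_injective_0)
  show ?thesis
  proof
    assume "inj ?D"
    then have "?D 1 \<noteq> 0"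
      unfolding inj using one_neq_zero by blast
    moreover have "?D 1 = 0" if "mat_deriv F z = 0"
      unfolding D pderiv_dir_cadjoint_mult[OF open_S hol hol z] that
      by (simp add: mat2_simps)
    ultimately show "mat_deriv F z \<noteq> 0"
      by blast
  next
    assume "mat_deriv F z \<noteq> 0"
    then have "sqnorm (right_log_deriv F z) \<noteq> 0"
      using sqnorm_pos_iff[of "right_log_deriv F z"] right_log_deriv_eq_0_iff by simp
    moreover have "mink 0 0 = 0"
      by (simp add: mink_trace trace_zero)
    ultimately have "v = 0" if "?D v = 0" for v
      using first_fundamental_form(1)[of v] that unfolding D by simp
    then show "inj ?D"
      unfolding inj by blast
  qed
qed

context
  assumes nz: "mat_deriv F z \<noteq> 0"
begin

lemma right_log_deriv_nonzero: "right_log_deriv F z \<noteq> 0"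
  using nz right_log_deriv_eq_0_iff by simp

lemma curve_normal_is_unit_normal:
  "cadjoint (curve_normal F z) = curve_normal F z"
  "mink (curve_normal F z) (curve_normal F z) = 1"
  "mink (curve_normal F z) (cadjoint (F z) ** F z) = 0"
  "mink (curve_normal F z) (pderiv_dir v (\<lambda>w. cadjoint (F w) ** F w) z) = 0"
proof -
  show "cadjoint (curve_normal F z) = curve_normal F z"
    by (simp add: curve_normal_def cadjoint_mult matrix_mul_assoc)
  show "mink (curve_normal F z) (curve_normal F z) = 1"
    by (simp add: curve_normal_def mink_congruence det_F z
        mink_normal_same[OF null_right_log_deriv right_log_deriv_nonzero])
  have "mink (curve_normal F z) (cadjoint (F z) ** mat 1 ** F z) = 0"
    unfolding curve_normal_def by (simp only: mink_congruence det_F z mink_normal_one)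
  then show "mink (curve_normal F z) (cadjoint (F z) ** F z) = 0"
    by simp
  show "mink (curve_normal F z) (pderiv_dir v (\<lambda>w. cadjoint (F w) ** F w) z) = 0"
    by (simp add: curve_normal_def pderiv_dir_curve mink_congruence det_F z
        mink_herm_scale[OF null_right_log_deriv])
qed

text \<open>Since the metric is conformal with factor \<open>q\<close>, the mean curvature is \<open>(l + k) / (2 * q)\<close>, where
  \<open>l + k\<close> is the normal component of the Laplacian. The latter is four times the matrix
  \<open>F'\<^sup>* F'\<close>, whose component along the normal is \<open>q / 2\<close>.\<close>

lemma mean_curvature_curve:
  assumes n: "n z = curve_normal F z"
  shows "mean_curvature (\<lambda>w. cadjoint (F w) ** F w) n z = 1"
proof -
  let ?h = "\<lambda>w. cadjoint (F w) ** F w"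
  let ?b = "right_log_deriv F z"
  define l where "l = mink (pderiv_dir 1 (pderiv_dir 1 ?h) z) (n z)"
  define k where "k = mink (pderiv_dir \<i> (pderiv_dir \<i> ?h) z) (n z)"
  define q where "q = sqnorm ?b"
  have "q \<noteq> 0"
    using sqnorm_pos_iff[of ?b] right_log_deriv_nonzero by (simp add: q_def)
  have "cadjoint (mat_deriv F z) ** mat_deriv F z = cadjoint (F z) ** (cadjoint ?b ** ?b) ** F z"
    by (simp add: mat_deriv_eq_right_log_deriv cadjoint_mult matrix_mul_assoc)
  then have "l + k = 2 * q"
    unfolding l_def k_def mink_add_left[symmetric] laplacian_cadjoint_mult[OF open_S hol z]
      mink_scaleR_left n curve_normal_def
    by (simp add: mink_congruence det_F z mink_normal_square[OF null_right_log_deriv right_log_deriv_nonzero]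
        q_def)
  moreover have "mean_curvature ?h n z = (l * q + k * q) / (2 * (q * q))"
    using first_fundamental_form
    by (simp add: mean_curvature_def Let_def l_def k_def q_def)
  moreover have "l * q + k * q = (l + k) * q"
    by (simp add: algebra_simps)
  ultimately show ?thesis
    using \<open>q \<noteq> 0\<close> by simp
qed

end

end

lemma continuous_on_curve_normal:
  assumes "open S" and hol: "mat_holomorphic_on F S"
    and nz: "\<And>w. w \<in> S \<Longrightarrow> right_log_deriv F w \<noteq> 0"
  shows "continuous_on S (curve_normal F)"
proof -
  have cont: "continuous_on S G" if "mat_holomorphic_on G S" for G
    using has_derivative_mat_holomorphic[OF assms(1) that]
    by (intro continuous_at_imp_continuous_on ballI) (rule has_derivative_continuous)
  have mult: "continuous_on S (\<lambda>w. G w ** H w)"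
    if "continuous_on S G" "continuous_on S H" for G H :: "complex \<Rightarrow> complex^2^2"
    unfolding matrix_matrix_mult_def
    by (intro continuous_on_vec_lambda continuous_on_sum continuous_on_mult
        continuous_on_component that)
  have adj: "continuous_on S (\<lambda>w. cadjoint (G w))"
    if "continuous_on S G" for G :: "complex \<Rightarrow> complex^2^2"
    unfolding cadjoint_def
    by (intro continuous_on_vec_lambda continuous_on_cnj continuous_on_component that)
  have tr: "continuous_on S (\<lambda>w. trace (G w))"
    if "continuous_on S G" for G :: "complex \<Rightarrow> complex^2^2"
    unfolding trace_def by (intro continuous_on_sum continuous_on_component that)
  have "mat_holomorphic_on (right_log_deriv F) S"
    unfolding right_log_deriv_def
    by (intro mat_holomorphic_on_mult mat_holomorphic_on_deriv mat_holomorphic_on_adj2 assms)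
  then have b: "continuous_on S (right_log_deriv F)"
    by (rule cont)
  have "sqnorm (right_log_deriv F w) \<noteq> 0" if "w \<in> S" for w
    using nz[OF that] sqnorm_pos_iff[of "right_log_deriv F w"] by simp
  then have "continuous_on S (\<lambda>w. normal_dir (right_log_deriv F w))"
    unfolding normal_dir_def sqnorm_def
    by (intro continuous_intros mult adj tr b) (auto simp: sqnorm_def)
  then show ?thesis
    unfolding curve_normal_def by (intro mult adj cont[OF hol])
qed

section \<open>The surface of a null curve on a Riemann surface\<close>

context
  fixes M :: "'a topology" and \<A> :: "'a chart set"
  assumes M: "riemann_surface M \<A>"
begin

lemma chart_cover:
  assumes "p \<in> topspace M"
  shows "\<exists>c\<in>\<A>. p \<in> fst c"
proof -
  have "p \<in> (\<Union>c\<in>\<A>. fst c)"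
    using M assms by (simp add: riemann_surface_def)
  then show ?thesis
    by blast
qed

context
  fixes c :: "'a chart"
  assumes c: "c \<in> \<A>"
begin

lemma chart_homeomorphic:
  "homeomorphic_map (subtopology M (fst c)) (top_of_set (chart_img c)) (snd c)"
  and open_chart_img: "open (chart_img c)"
  and openin_chart: "openin M (fst c)"
  using M c by (auto simp: riemann_surface_def is_chart_def)

lemma chart_topspace: "topspace (subtopology M (fst c)) = fst c"
  using openin_subset[OF openin_chart] by (simp add: inf_absorb2)

lemma inj_on_chart: "inj_on (snd c) (fst c)"
  using homeomorphic_imp_injective_map[OF chart_homeomorphic] chart_topspace by simp

lemma in_chart_at: "p \<in> fst c \<Longrightarrow> in_chart c f (snd c p) = f p"
  by (simp add: in_chart_def inv_into_f_f[OF inj_on_chart])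

lemma chart_point: "p \<in> fst c \<Longrightarrow> p \<in> topspace M \<and> snd c p \<in> chart_img c"
  using openin_subset[OF openin_chart] by (auto simp: chart_img_def)

lemma in_chart_values:
  assumes "\<And>p. p \<in> topspace M \<Longrightarrow> P (f p)" "z \<in> chart_img c"
  shows "P (in_chart c f z)"
proof -
  obtain p where "p \<in> fst c" "z = snd c p"
    using assms(2) by (auto simp: chart_img_def)
  then show ?thesis
    by (simp add: assms(1) chart_point in_chart_at)
qed

lemma open_chart_image:
  assumes "openin M U"
  shows "open (snd c ` (fst c \<inter> U))"
proof -
  have "openin (subtopology M (fst c)) (fst c \<inter> U)"
    using assms by (auto simp: openin_subtopology)
  then have "openin (top_of_set (chart_img c)) (snd c ` (fst c \<inter> U))"
    using homeomorphic_imp_open_map[OF chart_homeomorphic] by (simp add: open_map_def)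
  then show ?thesis
    using open_chart_img by (simp add: openin_open_eq)
qed

end

text \<open>The chain rule: the transition map is holomorphic, and its domain is open because charts are
  homeomorphisms.\<close>

lemma mat_deriv_chart_change:
  assumes c: "c \<in> \<A>" and d: "d \<in> \<A>" and p: "p \<in> fst c \<inter> fst d"
    and F: "holomorphic_map \<A> F"
  shows "mat_deriv (in_chart c F) (snd c p)
    = mat (deriv (in_chart c (snd d)) (snd c p)) ** mat_deriv (in_chart d F) (snd d p)"
proof (rule mat_deriv_eqI)
  fix i j
  let ?W = "snd c ` (fst c \<inter> fst d)"
  let ?t = "in_chart c (snd d)"
  have W: "open ?W" "snd c p \<in> ?W"
    using open_chart_image[OF c openin_chart[OF d]] p by auto
  have "?t holomorphic_on ?W"
    using M c d by (auto simp: riemann_surface_def)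
  then have t: "(?t has_field_derivative deriv ?t (snd c p)) (at (snd c p))"
    using W by (rule holomorphic_derivI)
  have tp: "?t (snd c p) = snd d p"
    using p by (simp add: in_chart_at[OF c])
  have "((\<lambda>w. in_chart d F w $ i $ j) has_field_derivative
      mat_deriv (in_chart d F) (snd d p) $ i $ j) (at (?t (snd c p)))"
    unfolding tp
    using F d p chart_point[OF d]
    by (intro mat_entry_has_field_derivative[OF open_chart_img[OF d]]) (auto simp: holomorphic_map_def)
  from DERIV_chain2[OF this t]
  have "((\<lambda>w. in_chart d F (?t w) $ i $ j) has_field_derivative
      mat_deriv (in_chart d F) (snd d p) $ i $ j * deriv ?t (snd c p)) (at (snd c p))" .
  moreover have "in_chart d F (?t w) $ i $ j = in_chart c F w $ i $ j" if "w \<in> ?W" for w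
    using that by (auto simp: in_chart_at[OF c] in_chart_at[OF d])
  ultimately have "((\<lambda>w. in_chart c F w $ i $ j) has_field_derivative
      mat_deriv (in_chart d F) (snd d p) $ i $ j * deriv ?t (snd c p)) (at (snd c p))"
    by (rule has_field_derivative_transform_within_open[OF _ W])
  then show "((\<lambda>w. in_chart c F w $ i $ j) has_field_derivative
      (mat (deriv ?t (snd c p)) ** mat_deriv (in_chart d F) (snd d p)) $ i $ j) (at (snd c p))"
    by (simp add: mult.commute)
qed

context
  fixes \<Psi> :: "'a \<Rightarrow> complex^2^2"
  assumes \<Psi>: "null_curve M \<A> \<Psi>"
begin

lemma null_curve_in_chart:
  assumes c: "c \<in> \<A>"
  shows "mat_holomorphic_on (in_chart c \<Psi>) (chart_img c)"
    and "\<And>z. z \<in> chart_img c \<Longrightarrow> det (in_chart c \<Psi> z) = 1"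
    and "\<And>z. z \<in> chart_img c \<Longrightarrow> det (mat_deriv (in_chart c \<Psi>) z) = 0"
  using \<Psi> c in_chart_values[OF c, of "\<lambda>x. x \<in> SL2C" \<Psi>]
  by (auto simp: null_curve_def holomorphic_map_def SL2C_def)

lemmas chart_facts = open_chart_img null_curve_in_chart

lemma in_chart_gram:
  "in_chart c (\<lambda>p. cadjoint (\<Psi> p) ** \<Psi> p) = (\<lambda>z. cadjoint (in_chart c \<Psi> z) ** in_chart c \<Psi> z)"
  by (simp add: in_chart_def o_def)

text \<open>Smoothness is automatic, so being an immersion is a condition on the derivative of the null curve
  alone. In this form the condition passes to the inverse curve.\<close>

lemma immersion_iff_regular:
  "immersion \<A> (\<lambda>p. cadjoint (\<Psi> p) ** \<Psi> p)
    \<longleftrightarrow> (\<forall>c\<in>\<A>. \<forall>z\<in>chart_img c. mat_deriv (in_chart c \<Psi>) z \<noteq> 0)"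
proof -
  have "Ck_on k (chart_img c) (in_chart c (\<lambda>p. cadjoint (\<Psi> p) ** \<Psi> p))" if "c \<in> \<A>" for c k
    unfolding in_chart_gram
    by (intro Ck_on_cadjoint_mult chart_facts that)
  moreover have "inj (frechet_derivative (in_chart c (\<lambda>p. cadjoint (\<Psi> p) ** \<Psi> p)) (at z))
      \<longleftrightarrow> mat_deriv (in_chart c \<Psi>) z \<noteq> 0" if "c \<in> \<A>" "z \<in> chart_img c" for c z
    unfolding in_chart_gram
    by (rule inj_frechet_derivative_curve_iff[of "chart_img c"]) (use chart_facts that in auto)
  ultimately show ?thesis
    by (simp add: immersion_def)
qed

context
  assumes imm: "immersion \<A> (\<lambda>p. cadjoint (\<Psi> p) ** \<Psi> p)"
begin

lemma regular: "c \<in> \<A> \<Longrightarrow> z \<in> chart_img c \<Longrightarrow> mat_deriv (in_chart c \<Psi>) z \<noteq> 0"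
  using imm immersion_iff_regular by blast

text \<open>A change of chart multiplies the derivative by a scalar, which is nonzero because the curve is
  regular, and the normal is insensitive to such a factor.\<close>

lemma curve_normal_chart_change:
  assumes c: "c \<in> \<A>" and d: "d \<in> \<A>" and p: "p \<in> fst c \<inter> fst d"
  shows "curve_normal (in_chart c \<Psi>) (snd c p) = curve_normal (in_chart d \<Psi>) (snd d p)"
proof -
  define k where "k = deriv (in_chart c (snd d)) (snd c p)"
  have D: "mat_deriv (in_chart c \<Psi>) (snd c p) = mat k ** mat_deriv (in_chart d \<Psi>) (snd d p)"
    unfolding k_def using \<Psi> by (intro mat_deriv_chart_change assms) (simp add: null_curve_def)
  have "mat_deriv (in_chart c \<Psi>) (snd c p) \<noteq> 0"
    using regular c p chart_point by blast
  then have "k \<noteq> 0"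
    unfolding D by auto
  moreover have "in_chart c \<Psi> (snd c p) = in_chart d \<Psi> (snd d p)"
    using c d p by (simp add: in_chart_at)
  ultimately show ?thesis
    by (simp add: curve_normal_def right_log_deriv_def D normal_dir_scale flip: matrix_mul_assoc)
qed

lemma ex_global_normal:
  "\<exists>n. continuous_map M euclidean n \<and>
    (\<forall>c\<in>\<A>. \<forall>z\<in>chart_img c. in_chart c n z = curve_normal (in_chart c \<Psi>) z)"
proof -
  define n where "n p = (let c = SOME c. c \<in> \<A> \<and> p \<in> fst c
    in curve_normal (in_chart c \<Psi>) (snd c p))" for p
  have n: "n p = curve_normal (in_chart c \<Psi>) (snd c p)" if "c \<in> \<A>" "p \<in> fst c" for c p
  proof -
    have "(SOME c. c \<in> \<A> \<and> p \<in> fst c) \<in> \<A> \<and> p \<in> fst (SOME c. c \<in> \<A> \<and> p \<in> fst c)"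
      by (rule someI[of _ c]) (use that in blast)
    then show ?thesis
      unfolding n_def Let_def using that by (intro curve_normal_chart_change) auto
  qed
  have "continuous_map M euclidean n"
  proof (rule pasting_lemma[where I = \<A> and T = fst
        and f = "\<lambda>c p. curve_normal (in_chart c \<Psi>) (snd c p)"])
    show "openin M (fst c)" if "c \<in> \<A>" for c
      using that by (rule openin_chart)
    show "continuous_map (subtopology M (fst c)) euclidean (\<lambda>p. curve_normal (in_chart c \<Psi>) (snd c p))"
      if c: "c \<in> \<A>" for c
    proof -
      have "continuous_on (chart_img c) (curve_normal (in_chart c \<Psi>))"
      proof (rule continuous_on_curve_normal)
        show "right_log_deriv (in_chart c \<Psi>) w \<noteq> 0" if "w \<in> chart_img c" for w
          using right_log_deriv_eq_0_iff[of "chart_img c" "in_chart c \<Psi>" w] chart_facts[OF c]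
            regular[OF c that] that by blast
      qed (use chart_facts[OF c] in auto)
      then have "continuous_map (top_of_set (chart_img c)) euclidean (curve_normal (in_chart c \<Psi>))"
        by simp
      from continuous_map_compose[OF homeomorphic_imp_continuous_map[OF chart_homeomorphic[OF c]] this]
      show ?thesis
        by (simp add: o_def)
    qed
    show "curve_normal (in_chart c \<Psi>) (snd c p) = curve_normal (in_chart d \<Psi>) (snd d p)"
      if "c \<in> \<A>" "d \<in> \<A>" "p \<in> topspace M \<inter> fst c \<inter> fst d" for c d p
      using that by (intro curve_normal_chart_change) auto
    show "\<exists>c. c \<in> \<A> \<and> p \<in> fst c \<and> n p = curve_normal (in_chart c \<Psi>) (snd c p)"
      if "p \<in> topspace M" for p
      using chart_cover[OF that] n by blast
  qed
  moreover have "in_chart c n z = curve_normal (in_chart c \<Psi>) z"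
    if c: "c \<in> \<A>" and z: "z \<in> chart_img c" for c z
  proof -
    obtain p where "p \<in> fst c" "z = snd c p"
      using z by (auto simp: chart_img_def)
    then show ?thesis
      by (simp add: n[OF c] in_chart_at[OF c])
  qed
  ultimately show ?thesis
    by blast
qed

text \<open>The local computations in all charts fit together since the normals of the charts agree on
  overlaps.\<close>

theorem null_curve_conformal_CMC1_immersion:
  "conformal_CMC1_immersion M \<A> (\<lambda>p. cadjoint (\<Psi> p) ** \<Psi> p)"
proof -
  let ?f = "\<lambda>p. cadjoint (\<Psi> p) ** \<Psi> p"
  obtain n where n_cont: "continuous_map M euclidean n"
    and n: "\<And>c z. c \<in> \<A> \<Longrightarrow> z \<in> chart_img c \<Longrightarrow> in_chart c n z = curve_normal (in_chart c \<Psi>) z"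
    using ex_global_normal by blast
  have "?f ` topspace M \<subseteq> H3"
    using \<Psi> by (auto simp: null_curve_def SL2C_def intro: H3_cadjoint_mult)
  moreover have "conformal \<A> ?f"
    unfolding conformal_def Let_def in_chart_gram
  proof (intro ballI conjI)
    fix c z
    assume c: "c \<in> \<A>" and z: "z \<in> chart_img c"
    note fff = first_fundamental_form[OF open_chart_img[OF c] null_curve_in_chart[OF c] z]
    let ?h = "\<lambda>z. cadjoint (in_chart c \<Psi> z) ** in_chart c \<Psi> z"
    show "mink (pderiv_dir 1 ?h z) (pderiv_dir 1 ?h z) = mink (pderiv_dir \<i> ?h z) (pderiv_dir \<i> ?h z)"
      using fff(1)[of 1] fff(1)[of \<i>] z by simp
    show "mink (pderiv_dir 1 ?h z) (pderiv_dir \<i> ?h z) = 0"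
      using fff(2) z by simp
  qed
  moreover have "unit_normal M \<A> ?f n"
    unfolding unit_normal_def
  proof (intro conjI n_cont ballI allI)
    note un = curve_normal_is_unit_normal[OF open_chart_img null_curve_in_chart _ regular]
    fix p
    assume "p \<in> topspace M"
    then obtain c where c: "c \<in> \<A>" "p \<in> fst c"
      using chart_cover by blast
    have img: "snd c p \<in> chart_img c"
      using chart_point[OF c] by simp
    have p: "n p = curve_normal (in_chart c \<Psi>) (snd c p)" "\<Psi> p = in_chart c \<Psi> (snd c p)"
      using n[OF c(1) img] by (simp_all add: in_chart_at[OF c])
    show "cadjoint (n p) = n p" "mink (n p) (n p) = 1" "mink (n p) (?f p) = 0"
      unfolding p using c(1) img by (auto intro!: un)
  next
    fix c z v
    assume c: "c \<in> \<A>" and z: "z \<in> chart_img c"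
    show "mink (in_chart c n z) (pderiv_dir v (in_chart c ?f) z) = 0"
      unfolding n[OF c z] in_chart_gram
      by (rule curve_normal_is_unit_normal(4)[OF open_chart_img null_curve_in_chart _ regular])
        (use c z in auto)
  qed
  moreover have "mean_curvature (in_chart c ?f) (in_chart c n) z = 1"
    if c: "c \<in> \<A>" and z: "z \<in> chart_img c" for c z
    unfolding in_chart_gram
    using mean_curvature_curve[OF open_chart_img[OF c] null_curve_in_chart[OF c] z
      regular[OF c z], of "in_chart c n"] n[OF c z] z by simp
  ultimately show ?thesis
    using imm by (auto simp: conformal_CMC1_immersion_def)
qed

end

end

end

section \<open>Inverse null curves and frames\<close>

text \<open>The inverse is the adjugate, hence its derivative is the adjugate of the derivative: one has
  determinant zero, or vanishes, exactly where the other does. Agreement with the inverse is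
  asked for on the surface only, as curves built from a frame have no meaning outside of it.\<close>

lemma null_curve_inverse:
  assumes M: "riemann_surface M \<A>" and \<Psi>: "null_curve M \<A> \<Psi>"
    and inv: "\<And>p. p \<in> topspace M \<Longrightarrow> \<Psi>' p = matrix_inv (\<Psi> p)"
  shows "null_curve M \<A> \<Psi>'"
    and "immersion \<A> (\<lambda>p. cadjoint (\<Psi>' p) ** \<Psi>' p) \<longleftrightarrow> immersion \<A> (\<lambda>p. cadjoint (\<Psi> p) ** \<Psi> p)"
proof -
  have adj: "\<Psi>' p = adj2 (\<Psi> p)" if "p \<in> topspace M" for p
    using that inv \<Psi> by (simp add: null_curve_def SL2C_def matrix_inv_eq_adj2)
  have chart: "in_chart c \<Psi>' z = adj2 (in_chart c \<Psi> z)" if c: "c \<in> \<A>" and z: "z \<in> chart_img c" for c z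
  proof -
    obtain p where p: "p \<in> fst c" "z = snd c p"
      using z by (auto simp: chart_img_def)
    then show ?thesis
      using adj chart_point[OF M c] by (simp add: in_chart_at[OF M c])
  qed
  have hol: "mat_holomorphic_on (in_chart c \<Psi>') (chart_img c)" if "c \<in> \<A>" for c
    using mat_holomorphic_on_cong[OF chart[OF that]]
      mat_holomorphic_on_adj2[OF null_curve_in_chart(1)[OF M \<Psi> that]] by simp
  have deriv: "mat_deriv (in_chart c \<Psi>') z = adj2 (mat_deriv (in_chart c \<Psi>) z)"
    if c: "c \<in> \<A>" and z: "z \<in> chart_img c" for c z
    using mat_deriv_cong[OF open_chart_img[OF M c] z chart[OF c]]
      mat_deriv_adj2[OF open_chart_img[OF M c] null_curve_in_chart(1)[OF M \<Psi> c] z] by simp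
  show "null_curve M \<A> \<Psi>'"
    unfolding null_curve_def holomorphic_map_def
    using \<Psi> adj hol deriv null_curve_in_chart(3)[OF M \<Psi>] by (auto simp: null_curve_def SL2C_def)
  then show "immersion \<A> (\<lambda>p. cadjoint (\<Psi>' p) ** \<Psi>' p) \<longleftrightarrow> immersion \<A> (\<lambda>p. cadjoint (\<Psi> p) ** \<Psi> p)"
    using deriv \<Psi> by (simp add: immersion_iff_regular[OF M])
qed

lemma matrix_inv_induced_curve:
  assumes "LWR_frame M \<A> \<Phi>" "p \<in> topspace M"
  shows "matrix_inv (induced_curve \<Phi> (a, b) p) = induced_curve \<Phi> (b, a) p"
proof -
  have "det (\<Phi> l p) = 1" for l
    using assms by (simp add: LWR_frame_def SL2C_def)
  then show ?thesis
    by (simp add: induced_curve_def matrix_inv_eq_adj2 det_mul adj2_mult)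
qed

lemma induced_map_eq:
  "induced_map \<Phi> e = (\<lambda>p. cadjoint (induced_curve \<Phi> e p) ** induced_curve \<Phi> e p)"
  by (rule ext) (simp add: induced_map_def)

text \<open>The derivative of \<open>\<Phi>\<^sub>b \<Phi>\<^sub>a\<^sup>-\<^sup>1\<close> is \<open>\<Phi>\<^sub>b (\<xi>\<^sub>b - \<xi>\<^sub>a) \<Phi>\<^sub>a\<^sup>-\<^sup>1\<close>. In the difference of the potentials the part \<open>B\<close>
  cancels, and \<open>(b - a) A\<close> is singular as \<open>A\<close> is nilpotent.\<close>

lemma null_curve_induced_curve:
  assumes M: "riemann_surface M \<A>" and \<Phi>: "LWR_frame M \<A> \<Phi>"
  shows "null_curve M \<A> (induced_curve \<Phi> (a, b))"
proof -
  let ?\<Psi> = "induced_curve \<Phi> (a, b)"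
  have det_\<Phi>: "det (\<Phi> l p) = 1" if "p \<in> topspace M" for l p
    using \<Phi> that by (simp add: LWR_frame_def SL2C_def)
  have "?\<Psi> p \<in> SL2C" if "p \<in> topspace M" for p
    using det_\<Phi>[OF that] by (simp add: induced_curve_def SL2C_def matrix_inv_eq_adj2 det_mul)
  moreover have "mat_holomorphic_on (in_chart c ?\<Psi>) (chart_img c)"
    and "\<And>z. z \<in> chart_img c \<Longrightarrow> det (mat_deriv (in_chart c ?\<Psi>) z) = 0" if c: "c \<in> \<A>" for c
  proof -
    let ?F = "\<lambda>l. in_chart c (\<Phi> l)"
    note op = open_chart_img[OF M c]
    have hol: "mat_holomorphic_on (?F l) (chart_img c)" for l
      using \<Phi> c by (simp add: LWR_frame_def holomorphic_map_def)
    have det_F: "det (?F l z) = 1" if "z \<in> chart_img c" for l z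
      using in_chart_values[OF M c _ that, of "\<lambda>x. det x = 1"] det_\<Phi> by blast
    have \<Psi>: "in_chart c ?\<Psi> z = ?F b z ** adj2 (?F a z)" if "z \<in> chart_img c" for z
      using matrix_inv_eq_adj2[OF det_F[OF that]] by (simp add: in_chart_def induced_curve_def)
    show "mat_holomorphic_on (in_chart c ?\<Psi>) (chart_img c)"
      using mat_holomorphic_on_cong[OF \<Psi>]
        mat_holomorphic_on_mult[OF hol mat_holomorphic_on_adj2[OF hol]] by simp
    show "det (mat_deriv (in_chart c ?\<Psi>) z) = 0" if z: "z \<in> chart_img c" for z
    proof -
      define \<xi> where "\<xi> l = log_deriv (\<Phi> l) c z" for l
      have "LWR_potential \<A> (\<lambda>l. log_deriv (\<Phi> l))"
        using \<Phi> by (simp add: LWR_frame_def)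
      then obtain A B where tr: "\<And>l. trace (\<xi> l) = 0" and A: "nilpotent_mat A"
        and \<xi>: "\<And>l. \<xi> l = mat l ** A + B"
        using c z unfolding LWR_potential_def \<xi>_def by blast
      have F': "mat_deriv (?F l) z = ?F l z ** \<xi> l" for l
        unfolding \<xi>_def log_deriv_def matrix_inv_eq_adj2[OF det_F[OF z]]
        by (simp add: matrix_mul_assoc mult_adj2 det_F[OF z])
      \<comment> \<open>The derivative of the inverse frame comes from that of its adjugate; on trace-free matrices
        the adjugate is negation.\<close>
      have "adj2 (\<xi> a) = - \<xi> a"
        by (simp add: adj2_def tr)
      then have "adj2 (mat_deriv (?F a) z) = - \<xi> a ** adj2 (?F a z)"
        by (simp add: F' adj2_mult)
      then have "mat_deriv (in_chart c ?\<Psi>) z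
        = ?F b z ** \<xi> b ** adj2 (?F a z) + ?F b z ** (- \<xi> a ** adj2 (?F a z))"
        using mat_deriv_cong[OF op z \<Psi>] mat_deriv_mult[OF op hol mat_holomorphic_on_adj2[OF hol] z]
          mat_deriv_adj2[OF op hol z] by (simp add: F')
      also have "\<dots> = ?F b z ** (\<xi> b - \<xi> a) ** adj2 (?F a z)"
        by (simp add: mat2_eq_iff mat2_mult_nth algebra_simps)
      also have "\<xi> b - \<xi> a = mat (b - a) ** A"
        by (simp add: \<xi> mat2_eq_iff algebra_simps)
      finally show ?thesis
        by (simp add: det_mul det_eq_0_if_nilpotent[OF A])
    qed
  qed
  ultimately show ?thesis
    by (auto simp: null_curve_def holomorphic_map_def)
qed

theorem theorem4p4:
  fixes M :: "'a topology" and \<A> :: "'a chart set"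
    and \<Phi> :: "complex \<Rightarrow> 'a \<Rightarrow> complex^2^2" and l0 l1 :: complex
  assumes "riemann_surface M \<A>"
    and "LWR_frame M \<A> \<Phi>"
    and "l0 \<noteq> l1"
    and "immersion \<A> (induced_map \<Phi> (l0, l1))"
  shows "is_dual M \<A> (induced_curve \<Phi> (l0, l1))
           (induced_map \<Phi> (l0, l1)) (induced_map \<Phi> (l1, l0)) \<and>
         conformal_CMC1_immersion M \<A> (induced_map \<Phi> (l1, l0))"
proof -
  note M = assms(1)
  note null = null_curve_induced_curve[OF assms(1,2)]
  note inv = matrix_inv_induced_curve[OF assms(2)]
  have imm: "immersion \<A> (induced_map \<Phi> (l1, l0))"
    using null_curve_inverse(2)[OF M null inv[symmetric]] assms(4)
    by (simp add: induced_map_eq)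
  have "conformal_CMC1_immersion M \<A> (induced_map \<Phi> (l0, l1))"
    "conformal_CMC1_immersion M \<A> (induced_map \<Phi> (l1, l0))"
    using null_curve_conformal_CMC1_immersion[OF M null] assms(4) imm
    by (simp_all add: induced_map_eq)
  then show ?thesis
    using null inv by (simp add: is_dual_def induced_map_def)
qed

end
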